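(* Let $B$ be a derivation-finite algebra over a field $\mathbf{k}$ and let $\mathscr{L}$ be a Lie subalgebra of $\operatorname{Der}_{\mathbf{k}}(B)$. If $\mathscr{L}$ is weakly locally finite and $\Delta$ is a subset of $\operatorname{LFD}_{\mathbf{k}}(B)$ such that $[\Delta,\Delta]\subseteq\mathscr{L}$ and $[\Delta,\mathscr{L}]\subseteq\mathscr{L}$, then the Lie subalgebra $\mathscr{M}$ of $\operatorname{Der}_{\mathbf{k}}(B)$ generated by $\Delta\cup\mathscr{L}$ is weakly locally finite and $[\mathscr{M},\mathscr{M}]\subseteq\mathscr{L}$.
   Context: An algebra over a field $\mathbf{k}$ is a $\mathbf{k}$-vector space $B$ together with an arbitrary $\mathbf{k}$-bilinear map $B\times B\to B$, $(x,y)\mapsto x\cdot y$ (not assumed commutative, associative or unital). A $\mathbf{k}$-derivation of $B$ is a $\mathbf{k}$-linear map $D:B\to B$ with $D(x\cdot y)=D(x)\cdot y+x\cdot D(y)$ for all $x,y\in B$. The set $\operatorname{Der}_{\mathbf{k}}(B)$ of all $\mathbf{k}$-derivations of $B$ is a Lie algebra over $\mathbf{k}$ with bracket $[D,E]=D\circ E-E\circ D$. For subsets $X,Y$ of a Lie algebra, $[X,Y]$ denotes the set $\{[x,y]\mid x\in X,\ y\in Y\}$. $B$ is derivation-finite if there exists a finite subset $F$ of $B$ such that the only $D\in\operatorname{Der}_{\mathbf{k}}(B)$ satisfying $D(x)=0$ for all $x\in F$ is $D=0$. A subset $\Delta$ of $\operatorname{Der}_{\mathbf{k}}(B)$ is locally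 finite if for each $b\in B$ there exists a finite dimensional $\mathbf{k}$-linear subspace $U$ of $B$ such that $b\in U$ and $D(U)\subseteq U$ for all $D\in\Delta$. It is weakly locally finite if every finite subset of $\Delta$ is locally finite. A derivation $D\in\operatorname{Der}_{\mathbf{k}}(B)$ is locally finite if $\{D\}$ is a locally finite set; $\operatorname{LFD}_{\mathbf{k}}(B)$ denotes the set of locally finite $\mathbf{k}$-derivations of $B$. *)

theory Defs
  imports Complex_Main
begin

text \<open>
  The underlying vector space is the whole type \<open>'b\<close>, with scalar multiplication \<open>scale\<close>; the
  product \<open>mult\<close> is an arbitrary bilinear map. Maps from the algebra to itself are plain functions
  of type \<open>'b \<Rightarrow> 'b\<close>, with pointwise addition and scaling.
\<close>

locale nonassoc_algebra = vector_space scale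
  for scale :: "'a::field \<Rightarrow> 'b::ab_group_add \<Rightarrow> 'b" +
  fixes mult :: "'b \<Rightarrow> 'b \<Rightarrow> 'b"
  assumes linear_mult_left: "\<And>y. Vector_Spaces.linear scale scale (\<lambda>x. mult x y)"
    and linear_mult_right: "\<And>x. Vector_Spaces.linear scale scale (\<lambda>y. mult x y)"

definition Der ::
    "('a::field \<Rightarrow> 'b::ab_group_add \<Rightarrow> 'b) \<Rightarrow> ('b \<Rightarrow> 'b \<Rightarrow> 'b) \<Rightarrow> ('b \<Rightarrow> 'b) set" where
  "Der scale mult =
    {D. Vector_Spaces.linear scale scale D \<and>
        (\<forall>x y. D (mult x y) = mult (D x) y + mult x (D y))}"

definition bracket :: "('b::ab_group_add \<Rightarrow> 'b) \<Rightarrow> ('b \<Rightarrow> 'b) \<Rightarrow> 'b \<Rightarrow> 'b" where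
  "bracket D E = (\<lambda>x. D (E x) - E (D x))"

text \<open>This is only the set of brackets, not its linear span.\<close>

definition bracket_set :: "('b::ab_group_add \<Rightarrow> 'b) set \<Rightarrow> ('b \<Rightarrow> 'b) set \<Rightarrow> ('b \<Rightarrow> 'b) set" where
  "bracket_set X Y = {bracket D E | D E. D \<in> X \<and> E \<in> Y}"

definition lie_subalgebra ::
    "('a::field \<Rightarrow> 'b::ab_group_add \<Rightarrow> 'b) \<Rightarrow> ('b \<Rightarrow> 'b \<Rightarrow> 'b) \<Rightarrow> ('b \<Rightarrow> 'b) set \<Rightarrow> bool" where
  "lie_subalgebra scale mult L \<longleftrightarrow>
    L \<subseteq> Der scale mult \<and>
    (\<lambda>x. 0) \<in> L \<and>
    (\<forall>D\<in>L. \<forall>E\<in>L. (\<lambda>x. D x + E x) \<in> L) \<and>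
    (\<forall>c. \<forall>D\<in>L. (\<lambda>x. scale c (D x)) \<in> L) \<and>
    (\<forall>D\<in>L. \<forall>E\<in>L. bracket D E \<in> L)"

definition lie_generated ::
    "('a::field \<Rightarrow> 'b::ab_group_add \<Rightarrow> 'b) \<Rightarrow> ('b \<Rightarrow> 'b \<Rightarrow> 'b) \<Rightarrow> ('b \<Rightarrow> 'b) set \<Rightarrow> ('b \<Rightarrow> 'b) set" where
  "lie_generated scale mult X = (lie_subalgebra scale mult) hull X"

definition derivation_finite ::
    "('a::field \<Rightarrow> 'b::ab_group_add \<Rightarrow> 'b) \<Rightarrow> ('b \<Rightarrow> 'b \<Rightarrow> 'b) \<Rightarrow> bool" where
  "derivation_finite scale mult \<longleftrightarrow>
    (\<exists>F. finite F \<and> (\<forall>D\<in>Der scale mult. (\<forall>x\<in>F. D x = 0) \<longrightarrow> D = (\<lambda>x. 0)))"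

definition fin_dim_subspace :: "('a::field \<Rightarrow> 'b::ab_group_add \<Rightarrow> 'b) \<Rightarrow> 'b set \<Rightarrow> bool" where
  "fin_dim_subspace scale U \<longleftrightarrow>
    module.subspace scale U \<and> (\<exists>S. finite S \<and> module.span scale S = U)"

text \<open>
  The next two notions make sense for arbitrary sets of maps; they are meant for subsets of
  \<^term>\<open>Der scale mult\<close>.
\<close>

definition locally_finite ::
    "('a::field \<Rightarrow> 'b::ab_group_add \<Rightarrow> 'b) \<Rightarrow> ('b \<Rightarrow> 'b) set \<Rightarrow> bool" where
  "locally_finite scale \<Delta> \<longleftrightarrow>
    (\<forall>b. \<exists>U. fin_dim_subspace scale U \<and> b \<in> U \<and> (\<forall>D\<in>\<Delta>. D ` U \<subseteq> U))"

definition weakly_locally_finite ::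
    "('a::field \<Rightarrow> 'b::ab_group_add \<Rightarrow> 'b) \<Rightarrow> ('b \<Rightarrow> 'b) set \<Rightarrow> bool" where
  "weakly_locally_finite scale \<Delta> \<longleftrightarrow> (\<forall>F. F \<subseteq> \<Delta> \<and> finite F \<longrightarrow> locally_finite scale F)"

definition LFD ::
    "('a::field \<Rightarrow> 'b::ab_group_add \<Rightarrow> 'b) \<Rightarrow> ('b \<Rightarrow> 'b \<Rightarrow> 'b) \<Rightarrow> ('b \<Rightarrow> 'b) set" where
  "LFD scale mult = {D \<in> Der scale mult. locally_finite scale {D}}"

context nonassoc_algebra
begin

lemma mult_simps:
  "mult (x + y) z = mult x z + mult y z" "mult z (x + y) = mult z x + mult z y"
  "mult (x - y) z = mult x z - mult y z" "mult z (x - y) = mult z x - mult z y"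
  "mult (scale c x) z = scale c (mult x z)" "mult z (scale c x) = scale c (mult z x)"
  "mult 0 z = 0" "mult z 0 = 0"
proof -
  interpret l: Vector_Spaces.linear scale scale "\<lambda>x. mult x z" by (rule linear_mult_left)
  interpret r: Vector_Spaces.linear scale scale "\<lambda>x. mult z x" by (rule linear_mult_right)
  show "mult (x + y) z = mult x z + mult y z" "mult z (x + y) = mult z x + mult z y"
    "mult (x - y) z = mult x z - mult y z" "mult z (x - y) = mult z x - mult z y"
    "mult (scale c x) z = scale c (mult x z)" "mult z (scale c x) = scale c (mult z x)"
    "mult 0 z = 0" "mult z 0 = 0"
    by (simp_all add: l.add r.add l.diff r.diff l.scale r.scale l.zero r.zero)
qed

lemma Der_iff:
  "D \<in> Der scale mult \<longleftrightarrow>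
    (\<forall>x y. D (x + y) = D x + D y) \<and> (\<forall>c x. D (scale c x) = scale c (D x)) \<and>
    (\<forall>x y. D (mult x y) = mult (D x) y + mult x (D y))"
proof -
  have "Vector_Spaces.linear scale scale D \<longleftrightarrow>
      (\<forall>x y. D (x + y) = D x + D y) \<and> (\<forall>c x. D (scale c x) = scale c (D x))"
    unfolding Vector_Spaces.linear_iff using vector_space_axioms by simp
  then show ?thesis
    unfolding Der_def by simp
qed

lemma bracket_in_Der:
  assumes D: "D \<in> Der scale mult" and E: "E \<in> Der scale mult"
  shows "bracket D E \<in> Der scale mult"
proof -
  have add: "D (x + y) = D x + D y" "E (x + y) = E x + E y"
    and scale: "D (scale c x) = scale c (D x)" "E (scale c x) = scale c (E x)"
    and prod: "D (mult x y) = mult (D x) y + mult x (D y)"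
      "E (mult x y) = mult (E x) y + mult x (E y)" for x y c
    using D E unfolding Der_iff by blast+
  show ?thesis
    unfolding Der_iff bracket_def
  proof (intro conjI allI)
    fix x y c
    show "D (E (x + y)) - E (D (x + y)) = D (E x) - E (D x) + (D (E y) - E (D y))"
      by (simp only: add) (simp add: algebra_simps)
    show "D (E (scale c x)) - E (D (scale c x)) = scale c (D (E x) - E (D x))"
      by (simp only: scale scale_right_diff_distrib)
    show "D (E (mult x y)) - E (D (mult x y)) =
        mult (D (E x) - E (D x)) y + mult x (D (E y) - E (D y))"
      by (simp only: prod add mult_simps) (simp add: algebra_simps)
  qed
qed

lemma lie_subalgebra_Der: "lie_subalgebra scale mult (Der scale mult)"
  unfolding lie_subalgebra_def
proof (intro conjI ballI allI)
  show "(\<lambda>x. 0) \<in> Der scale mult"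
    by (simp add: Der_iff mult_simps)
  fix D E c assume D: "D \<in> Der scale mult" and E: "E \<in> Der scale mult"
  show "(\<lambda>x. D x + E x) \<in> Der scale mult"
    using D E by (simp add: Der_iff mult_simps scale_right_distrib)
next
  fix D c assume D: "D \<in> Der scale mult"
  show "(\<lambda>x. scale c (D x)) \<in> Der scale mult"
    using D by (simp add: Der_iff mult_simps scale_right_distrib scale_left_commute)
qed (simp_all add: bracket_in_Der)

lemma lie_subalgebra_lie_generated:
  assumes "X \<subseteq> Der scale mult"
  shows "lie_subalgebra scale mult (lie_generated scale mult X)"
proof -
  have Inter: "lie_subalgebra scale mult (\<Inter>T)"
    if T: "\<And>L. L \<in> T \<Longrightarrow> lie_subalgebra scale mult L" and ne: "T \<noteq> {}" for T
  proof -
    from ne obtain L where "L \<in> T" by blast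
    then have "\<Inter>T \<subseteq> Der scale mult"
      using T[of L] unfolding lie_subalgebra_def by blast
    then show ?thesis
      using T unfolding lie_subalgebra_def by simp
  qed
  show ?thesis
    unfolding lie_generated_def hull_def
    by (rule Inter) (use lie_subalgebra_Der assms in auto)
qed

end

end

theory Submission
  imports Defs "HOL-Library.Function_Algebras"
begin

text \<open>
  Regard \<open>B \<Rightarrow> B\<close> as a vector space with pointwise operations. Brackets of elements of
  \<open>\<Delta> \<union> L\<close> lie in the subspace \<open>L\<close>, so by bilinearity all brackets of elements of
  \<open>span (\<Delta> \<union> L)\<close> do. Hence this span is already a Lie algebra; it contains the generated algebra
  \<open>M\<close>, and \<open>[M, M] \<subseteq> L\<close> follows. Weak local finiteness passes from a set of maps to its span, and
  only concerns finite subsets, so it is enough to adjoin the elements of \<open>\<Delta>\<close> to \<open>L\<close> one at a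
  time: if a subspace \<open>S\<close> of derivations is weakly locally finite and \<open>D\<close> is a locally finite
  derivation with \<open>[D, S] \<subseteq> S\<close>, then \<open>S \<union> {D}\<close> is weakly locally finite
  (\<open>weakly_locally_finite_insert_normalizing\<close>). This rests on two facts.

  The first (\<open>finite_ad_invariant_span\<close>) is where derivation-finiteness enters: \<open>ad D\<close> acts locally
  finitely on \<open>S\<close>. Let \<open>X\<close> be a finite set on which derivations are determined. Given a finite
  \<open>H \<subseteq> S\<close>, local finiteness of \<open>D\<close> gives finite-dimensional \<open>D\<close>-invariant subspaces
  \<open>U \<supseteq> X\<close> and \<open>W \<supseteq> \<Union>h\<in>H. h U\<close>. The maps in \<open>S\<close> that send \<open>U\<close> into \<open>W\<close> form a subspace that contains
  \<open>H\<close> and is invariant under \<open>ad D\<close>; it is finite-dimensional because restriction to \<open>X\<close> embeds it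
  into the space of functions \<open>X \<Rightarrow> W\<close>.

  The second (\<open>locally_finite_insert_normalizing\<close>): if a locally finite set \<open>B\<close> has a span invariant
  under \<open>ad D\<close>, then the least \<open>B\<close>-invariant subspace containing a \<open>D\<close>-invariant subspace
  is again \<open>D\<close>-invariant, as \<open>D E = E D + [D, E]\<close>.
\<close>

section \<open>Finite-dimensional subspaces and spaces of maps\<close>

context vector_space
begin

lemma vector_space_pointwise: "vector_space (\<lambda>c (f :: 'c \<Rightarrow> 'b) x. scale c (f x))"
  by unfold_locales (auto simp: fun_eq_iff scale_right_distrib scale_left_distrib)

interpretation maps: vector_space "\<lambda>c (f :: 'c \<Rightarrow> 'b) x. scale c (f x)"
  by (rule vector_space_pointwise)

lemma subspace_finite_basis:
  assumes "subspace U" "finite S" "U \<subseteq> span S"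
  shows "\<exists>B. finite B \<and> B \<subseteq> U \<and> span B = U"
proof -
  obtain B where B: "B \<subseteq> U" "independent B" "U \<subseteq> span B"
    by (rule maximal_independent_subset)
  have "finite B"
    using independent_span_bound[OF \<open>finite S\<close> B(2)] B(1) assms(3) by blast
  moreover have "span B = U"
    using B assms(1) by (simp add: span_subspace)
  ultimately show ?thesis
    using B by blast
qed

lemma fin_dim_subspace_iff:
  "fin_dim_subspace scale U \<longleftrightarrow> subspace U \<and> (\<exists>S. finite S \<and> U \<subseteq> span S)"
  unfolding fin_dim_subspace_def using subspace_finite_basis[of U] by (metis order_refl)

lemma fin_dim_subspace_span: "finite S \<Longrightarrow> fin_dim_subspace scale (span S)"
  unfolding fin_dim_subspace_def by auto

lemma subspace_maps_into:
  assumes "subspace W"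
  shows "maps.subspace {f. f ` U \<subseteq> W}"
  using assms by (auto simp: maps.subspace_def subspace_def image_subset_iff)

lemma subspace_eval_image:
  assumes K: "maps.subspace K"
  shows "subspace ((\<lambda>g. g x) ` K)"
  unfolding subspace_def
proof (intro conjI ballI allI)
  show "0 \<in> (\<lambda>g. g x) ` K"
    by (rule image_eqI[OF _ maps.subspace_0[OF K]]) simp
next
  fix u v assume "u \<in> (\<lambda>g. g x) ` K" "v \<in> (\<lambda>g. g x) ` K"
  then obtain f g where fg: "f \<in> K" "g \<in> K" "u = f x" "v = g x"
    by blast
  show "u + v \<in> (\<lambda>g. g x) ` K"
    by (rule image_eqI[OF _ maps.subspace_add[OF K fg(1,2)]]) (simp add: fg)
next
  fix c u assume "u \<in> (\<lambda>g. g x) ` K"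
  then obtain f where f: "f \<in> K" "u = f x"
    by blast
  show "scale c u \<in> (\<lambda>g. g x) ` K"
    by (rule image_eqI[OF _ maps.subspace_scale[OF K f(1), of c]]) (simp add: f)
qed

text \<open>
  A space of maps whose values at each of finitely many points span a finite-dimensional space is
  finite-dimensional modulo the maps that vanish at these points. The induction adds one point \<open>x\<close> at a
  time: what remains to be matched at \<open>x\<close> is the value of a map that vanishes at all earlier points,
  and finitely many such maps have values spanning all of these.
\<close>

lemma finite_span_agreeing_on:
  assumes "finite X" and G: "maps.subspace G"
    and vals: "\<And>x. x \<in> X \<Longrightarrow> \<exists>S. finite S \<and> (\<lambda>g. g x) ` G \<subseteq> span S"
  shows "\<exists>B. finite B \<and> B \<subseteq> G \<and> (\<forall>g\<in>G. \<exists>h\<in>maps.span B. \<forall>x\<in>X. g x = h x)"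
  using assms(1) vals
proof (induction X rule: finite_induct)
  case empty
  show ?case
    by (rule exI[of _ "{}"]) auto
next
  case (insert x X)
  obtain B where B: "finite B" "B \<subseteq> G" "\<forall>g\<in>G. \<exists>h\<in>maps.span B. \<forall>y\<in>X. g y = h y"
    using insert.IH insert.prems by blast
  define K where "K = {g \<in> G. \<forall>y\<in>X. g y = 0}"
  have K: "maps.subspace K"
    using G unfolding K_def by (auto simp: maps.subspace_def)
  obtain S where S: "finite S" "(\<lambda>g. g x) ` G \<subseteq> span S"
    using insert.prems by blast
  have "(\<lambda>g. g x) ` K \<subseteq> span S"
    using S(2) unfolding K_def by blast
  from subspace_finite_basis[OF subspace_eval_image[OF K] S(1) this]
  obtain C where C: "finite C" "C \<subseteq> (\<lambda>g. g x) ` K" "span C = (\<lambda>g. g x) ` K"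
    by blast
  then obtain B' where B': "finite B'" "B' \<subseteq> K" "C = (\<lambda>g. g x) ` B'"
    by (meson finite_subset_image)
  have spanB': "maps.span B' \<subseteq> K"
    using B' K by (simp add: maps.span_minimal)
  have spanC: "span C \<subseteq> (\<lambda>g. g x) ` maps.span B'"
    unfolding B'(3)
    by (intro span_minimal image_mono maps.span_superset subspace_eval_image maps.subspace_span)
  show ?case
  proof (intro exI[of _ "B \<union> B'"] conjI ballI)
    fix g assume g: "g \<in> G"
    obtain h where h: "h \<in> maps.span B" "\<forall>y\<in>X. g y = h y"
      using B g by blast
    have "h \<in> G"
      using h B G maps.span_minimal by blast
    then have "g - h \<in> K"
      using g h G by (simp add: K_def maps.subspace_diff)
    then obtain k where k: "k \<in> maps.span B'" "(g - h) x = k x"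
      using C(3) spanC by blast
    have "h + k \<in> maps.span (B \<union> B')"
      using h(1) k(1) maps.span_mono[of B "B \<union> B'"] maps.span_mono[of B' "B \<union> B'"]
      by (intro maps.span_add) auto
    moreover have "\<forall>y\<in>insert x X. g y = (h + k) y"
      using h k spanB' by (auto simp: K_def subset_iff algebra_simps)
    ultimately show "\<exists>h\<in>maps.span (B \<union> B'). \<forall>y\<in>insert x X. g y = h y"
      by blast
  qed (use B B' K_def in auto)
qed

section \<open>Local finiteness\<close>

text \<open>A subspace invariant under a set of maps is invariant under all their linear combinations.\<close>

lemma locally_finite_span:
  assumes "locally_finite scale \<Delta>"
  shows "locally_finite scale (maps.span \<Delta>)"
  unfolding locally_finite_def
proof
  fix b
  obtain U where U: "fin_dim_subspace scale U" "b \<in> U" "\<forall>D\<in>\<Delta>. D ` U \<subseteq> U"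
    using assms unfolding locally_finite_def by blast
  then have "maps.span \<Delta> \<subseteq> {f. f ` U \<subseteq> U}"
    by (intro maps.span_minimal subspace_maps_into) (auto simp: fin_dim_subspace_def)
  with U show "\<exists>U. fin_dim_subspace scale U \<and> b \<in> U \<and> (\<forall>D\<in>maps.span \<Delta>. D ` U \<subseteq> U)"
    by blast
qed

lemma locally_finite_mono: "locally_finite scale \<Delta> \<Longrightarrow> \<Gamma> \<subseteq> \<Delta> \<Longrightarrow> locally_finite scale \<Gamma>"
  unfolding locally_finite_def by (meson subsetD)

lemma weakly_locally_finite_mono:
  "weakly_locally_finite scale \<Delta> \<Longrightarrow> \<Gamma> \<subseteq> \<Delta> \<Longrightarrow> weakly_locally_finite scale \<Gamma>"
  unfolding weakly_locally_finite_def by (meson subset_trans)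

lemma weakly_locally_finite_span:
  assumes "weakly_locally_finite scale \<Delta>"
  shows "weakly_locally_finite scale (maps.span \<Delta>)"
  unfolding weakly_locally_finite_def
proof (intro allI impI, elim conjE)
  fix F assume F: "F \<subseteq> maps.span \<Delta>" "finite F"
  \<comment> \<open>Each of the finitely many maps involves only finitely many elements of \<open>\<Delta>\<close>.\<close>
  have "\<exists>T. finite T \<and> T \<subseteq> \<Delta> \<and> f \<in> maps.span T" if "f \<in> F" for f
  proof -
    have "f \<in> maps.span \<Delta>"
      using that F(1) by blast
    then obtain T r where T: "finite T" "T \<subseteq> \<Delta>" "f = (\<Sum>a\<in>T. (\<lambda>x. scale (r a) (a x)))"
      unfolding maps.span_explicit mem_Collect_eq by (elim exE conjE) (rule that)
    have "f \<in> maps.span T"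
      unfolding T(3) by (intro maps.span_sum maps.span_scale maps.span_base)
    with T show ?thesis
      by blast
  qed
  then obtain T where T: "\<And>f. f \<in> F \<Longrightarrow> finite (T f) \<and> T f \<subseteq> \<Delta> \<and> f \<in> maps.span (T f)"
    by metis
  have "f \<in> maps.span (\<Union>(T ` F))" if "f \<in> F" for f
    using T[OF that] maps.span_mono[of "T f" "\<Union>(T ` F)"] that by blast
  then have "F \<subseteq> maps.span (\<Union>(T ` F))"
    by blast
  moreover have "finite (\<Union>(T ` F))" "\<Union>(T ` F) \<subseteq> \<Delta>"
    using T F(2) by auto
  then have "locally_finite scale (\<Union>(T ` F))"
    using assms unfolding weakly_locally_finite_def by simp
  ultimately show "locally_finite scale F"
    using locally_finite_mono locally_finite_span by blast
qed

text \<open>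
  Local finiteness provides an invariant subspace for each single vector; linearity makes the sum of
  finitely many of them invariant.
\<close>

lemma invariant_fin_dim_superspace:
  assumes lf: "locally_finite scale \<Delta>"
    and lin: "\<And>D. D \<in> \<Delta> \<Longrightarrow> Vector_Spaces.linear scale scale D"
    and "finite X"
  obtains U where "fin_dim_subspace scale U" "X \<subseteq> U" "\<forall>D\<in>\<Delta>. D ` U \<subseteq> U"
proof -
  have "\<exists>S. finite S \<and> b \<in> span S \<and> (\<forall>D\<in>\<Delta>. D ` span S \<subseteq> span S)" for b
    using lf unfolding locally_finite_def fin_dim_subspace_def by metis
  then obtain S where S: "\<And>b. finite (S b)" "\<And>b. b \<in> span (S b)"
      "\<And>b D. D \<in> \<Delta> \<Longrightarrow> D ` span (S b) \<subseteq> span (S b)"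
    by metis
  let ?S = "\<Union>b\<in>X. S b"
  have up: "span (S b) \<subseteq> span ?S" if "b \<in> X" for b
    using that by (intro span_mono) auto
  show thesis
  proof
    show "fin_dim_subspace scale (span ?S)"
      using S assms(3) by (simp add: fin_dim_subspace_span)
    show "X \<subseteq> span ?S"
      using subsetD[OF up S(2)] by (rule subsetI)
    show "\<forall>D\<in>\<Delta>. D ` span ?S \<subseteq> span ?S"
    proof
      fix D assume D: "D \<in> \<Delta>"
      interpret D: Vector_Spaces.linear scale scale D by (rule lin[OF D])
      have "D s \<in> span ?S" if "b \<in> X" "s \<in> S b" for b s
        using subsetD[OF up[OF that(1)]] subsetD[OF S(3)[OF D] imageI] span_base[OF that(2)] by simp
      then have "D ` ?S \<subseteq> span ?S"
        by auto
      then show "D ` span ?S \<subseteq> span ?S"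
        unfolding D.span_image[symmetric] by (simp add: span_minimal)
    qed
  qed
qed

lemma bracket_span_left:
  assumes "maps.subspace L" "\<And>D. D \<in> X \<Longrightarrow> bracket D E \<in> L"
    and "Vector_Spaces.linear scale scale E" and "D \<in> maps.span X"
  shows "bracket D E \<in> L"
proof -
  interpret E: Vector_Spaces.linear scale scale E by fact
  have "maps.subspace {D. bracket D E \<in> L}"
    unfolding maps.subspace_def
  proof (intro conjI ballI allI; clarsimp)
    show "bracket 0 E \<in> L"
      using maps.subspace_0[OF assms(1)] by (simp add: bracket_def E.zero zero_fun_def)
  next
    fix A B assume "bracket A E \<in> L" "bracket B E \<in> L"
    from maps.subspace_add[OF assms(1) this] show "bracket (A + B) E \<in> L"
      by (simp add: bracket_def E.add plus_fun_def algebra_simps)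
  next
    fix c A assume "bracket A E \<in> L"
    from maps.subspace_scale[OF assms(1) this, of c] show "bracket (\<lambda>x. scale c (A x)) E \<in> L"
      by (simp add: bracket_def E.scale scale_right_diff_distrib)
  qed
  then show ?thesis
    using maps.span_minimal[of X "{D. bracket D E \<in> L}"] assms by blast
qed

lemma bracket_commute_mem:
  assumes "maps.subspace L" "bracket D E \<in> L"
  shows "bracket E D \<in> L"
  using maps.subspace_neg[OF assms] by (simp add: bracket_def fun_Compl_def)

text \<open>
  Let \<open>U\<close> be a finite-dimensional \<open>D\<close>-invariant subspace and \<open>W\<close> the least \<open>B\<close>-invariant subspace
  containing it, which is finite-dimensional because \<open>B\<close> is locally finite. The vectors of \<open>W\<close> that
  \<open>D\<close> keeps in \<open>W\<close> form a subspace containing \<open>U\<close>, and the identity \<open>D E = E D + [D, E]\<close> shows that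
  it is \<open>B\<close>-invariant; by minimality it is all of \<open>W\<close>.
\<close>

lemma locally_finite_insert_normalizing:
  assumes lf: "locally_finite scale B" "locally_finite scale {D}"
    and linB: "\<And>E. E \<in> B \<Longrightarrow> Vector_Spaces.linear scale scale E"
    and linD: "Vector_Spaces.linear scale scale D"
    and ad: "\<And>E. E \<in> B \<Longrightarrow> bracket D E \<in> maps.span B"
  shows "locally_finite scale (insert D B)"
  unfolding locally_finite_def
proof
  fix b
  interpret D: Vector_Spaces.linear scale scale D by (rule linD)
  obtain U where U: "fin_dim_subspace scale U" "b \<in> U" "D ` U \<subseteq> U"
    using lf(2) unfolding locally_finite_def by (metis singletonI)
  then obtain S where S: "finite S" "span S = U"
    unfolding fin_dim_subspace_def by blast
  obtain V where V: "fin_dim_subspace scale V" "S \<subseteq> V" "\<forall>E\<in>B. E ` V \<subseteq> V"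
    by (rule invariant_fin_dim_superspace[OF lf(1) linB S(1)])
  have subV: "subspace V"
    using V(1) by (simp add: fin_dim_subspace_def)
  have UV: "U \<subseteq> V"
    using S(2) span_minimal[OF V(2) subV] by simp
  define C where "C = {W. subspace W \<and> U \<subseteq> W \<and> (\<forall>E\<in>B. E ` W \<subseteq> W)}"
  define W where "W = \<Inter>C"
  have VC: "V \<in> C"
    using V subV UV by (simp add: C_def)
  have least: "W \<subseteq> W'" if "W' \<in> C" for W'
    using that unfolding W_def by blast
  have subW: "subspace W"
    unfolding W_def C_def by (rule subspace_Inter) blast
  have UW: "U \<subseteq> W"
    unfolding W_def C_def by blast
  have BW: "E w \<in> W" if "E \<in> B" "w \<in> W" for E w
    using that unfolding W_def C_def by blast
  have span_BW: "E w \<in> W" if "E \<in> maps.span B" "w \<in> W" for E w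
  proof -
    have "maps.span B \<subseteq> {f. f ` W \<subseteq> W}"
      using BW by (intro maps.span_minimal subspace_maps_into subW) blast
    then show ?thesis
      using that by blast
  qed
  have "{w \<in> W. D w \<in> W} \<in> C"
    unfolding C_def
  proof (intro CollectI conjI ballI)
    show "subspace {w \<in> W. D w \<in> W}"
      using subW by (auto simp: subspace_def D.add D.scale D.zero)
    show "U \<subseteq> {w \<in> W. D w \<in> W}"
      using UW U(3) by blast
    fix E assume E: "E \<in> B"
    show "E ` {w \<in> W. D w \<in> W} \<subseteq> {w \<in> W. D w \<in> W}"
    proof (rule image_subsetI)
      fix w assume "w \<in> {w \<in> W. D w \<in> W}"
      then have w: "w \<in> W" "D w \<in> W"
        by simp_all
      have "D (E w) = E (D w) + bracket D E w"
        by (simp add: bracket_def)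
      also have "\<dots> \<in> W"
        by (rule subspace_add[OF subW BW[OF E w(2)] span_BW[OF ad[OF E] w(1)]])
      finally show "E w \<in> {w \<in> W. D w \<in> W}"
        using BW[OF E w(1)] by simp
    qed
  qed
  from least[OF this] have DW: "D ` W \<subseteq> W"
    by auto
  have "fin_dim_subspace scale W"
    using V(1) subW least[OF VC] unfolding fin_dim_subspace_iff by blast
  moreover have "\<forall>E\<in>insert D B. E ` W \<subseteq> W"
    using DW BW by (simp add: image_subset_iff)
  ultimately show "\<exists>W. fin_dim_subspace scale W \<and> b \<in> W \<and> (\<forall>E\<in>insert D B. E ` W \<subseteq> W)"
    using UW U(2) by blast
qed

end

section \<open>Derivations\<close>

context nonassoc_algebra
begin

interpretation maps: vector_space "\<lambda>c (f :: 'b \<Rightarrow> 'b) x. scale c (f x)"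
  by (rule vector_space_pointwise)

lemma lie_subalgebra_iff:
  "lie_subalgebra scale mult L \<longleftrightarrow>
    L \<subseteq> Der scale mult \<and> maps.subspace L \<and> (\<forall>D\<in>L. \<forall>E\<in>L. bracket D E \<in> L)"
  unfolding lie_subalgebra_def maps.subspace_def plus_fun_def zero_fun_def by blast

lemma linear_Der: "D \<in> Der scale mult \<Longrightarrow> Vector_Spaces.linear scale scale D"
  by (simp add: Der_def)

text \<open>
  The finite-dimensional space is found as a whole, namely as the space \<open>G\<close> of all \<open>g \<in> S\<close> mapping a
  suitable \<open>U\<close> into a suitable \<open>W\<close>, rather than by tracking the iterated brackets of \<open>D\<close> with each
  element of \<open>H\<close>.
\<close>

lemma finite_ad_invariant_span:
  assumes df: "derivation_finite scale mult"
    and S: "maps.subspace S" "S \<subseteq> Der scale mult"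
    and D: "D \<in> LFD scale mult" and ad: "\<And>E. E \<in> S \<Longrightarrow> bracket D E \<in> S"
    and H: "finite H" "H \<subseteq> S"
  obtains B where "finite B" "B \<subseteq> S" "H \<subseteq> maps.span B"
    "\<forall>E\<in>B. bracket D E \<in> maps.span B"
proof -
  have lfD: "locally_finite scale {D}" and linD: "Vector_Spaces.linear scale scale D"
    using D by (auto simp: LFD_def Der_def)
  obtain X where X: "finite X" "\<And>E. E \<in> Der scale mult \<Longrightarrow> \<forall>x\<in>X. E x = 0 \<Longrightarrow> E = 0"
    using df unfolding derivation_finite_def zero_fun_def by blast
  obtain U where U: "fin_dim_subspace scale U" "X \<subseteq> U" "D ` U \<subseteq> U"
    by (rule invariant_fin_dim_superspace[OF lfD _ X(1)]) (use linD in auto)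
  then obtain T where T: "finite T" "span T = U"
    unfolding fin_dim_subspace_def by blast
  have "finite (\<Union>h\<in>H. h ` T)"
    using T H by blast
  then obtain W where W: "fin_dim_subspace scale W" "(\<Union>h\<in>H. h ` T) \<subseteq> W" "D ` W \<subseteq> W"
    by (rule invariant_fin_dim_superspace[OF lfD, rotated]) (use linD in auto)
  have subW: "subspace W"
    using W(1) by (simp add: fin_dim_subspace_def)
  define G where "G = S \<inter> {g. g ` U \<subseteq> W}"
  have G: "maps.subspace G"
    unfolding G_def by (intro maps.subspace_inter S(1) subspace_maps_into subW)
  have "h ` U \<subseteq> W" if "h \<in> H" for h
  proof -
    interpret h: Vector_Spaces.linear scale scale h
      using that H S linear_Der by blast
    show ?thesis
      using W(2) that unfolding T(2)[symmetric] h.span_image[symmetric]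
      by (intro span_minimal subW) blast
  qed
  then have HG: "H \<subseteq> G"
    using H by (auto simp: G_def)
  \<comment> \<open>\<open>[D, g]\<close> sends \<open>U\<close> into \<open>W\<close> because \<open>D\<close> preserves both spaces.\<close>
  have adG: "bracket D g \<in> G" if "g \<in> G" for g
  proof -
    have "D (g u) - g (D u) \<in> W" if "u \<in> U" for u
      using that \<open>g \<in> G\<close> U(3) W(3) unfolding G_def by (intro subspace_diff[OF subW]) blast+
    then show ?thesis
      using that ad by (auto simp: G_def bracket_def)
  qed
  obtain C where C: "finite C" "W \<subseteq> span C"
    using W(1) unfolding fin_dim_subspace_iff by blast
  have "(\<lambda>g. g x) ` G \<subseteq> span C" if "x \<in> X" for x
    using subsetD[OF C(2)] subsetD[OF U(2) that] by (auto simp: G_def)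
  then have "\<exists>S. finite S \<and> (\<lambda>g. g x) ` G \<subseteq> span S" if "x \<in> X" for x
    using C(1) that by blast
  then have "\<exists>B. finite B \<and> B \<subseteq> G \<and> (\<forall>g\<in>G. \<exists>h\<in>maps.span B. \<forall>x\<in>X. g x = h x)"
    by (rule finite_span_agreeing_on[OF X(1) G])
  then obtain B where B: "finite B" "B \<subseteq> G"
      "\<forall>g\<in>G. \<exists>h\<in>maps.span B. \<forall>x\<in>X. g x = h x"
    by (elim exE conjE) (rule that)
  have GB: "G \<subseteq> maps.span B"
  proof
    fix g assume g: "g \<in> G"
    obtain h where h: "h \<in> maps.span B" "\<forall>x\<in>X. g x = h x"
      using bspec[OF B(3) g] by (rule bexE)
    have "h \<in> G"
      using subsetD[OF maps.span_minimal[OF B(2) G] h(1)] .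
    then have "g - h \<in> G"
      by (rule maps.subspace_diff[OF G g])
    then have "g - h \<in> Der scale mult"
      using S(2) by (auto simp: G_def)
    then have "g - h = 0"
      by (rule X(2)) (simp add: h(2))
    then show "g \<in> maps.span B"
      using h by simp
  qed
  show thesis
  proof (rule that[OF B(1)])
    show "B \<subseteq> S"
      using B(2) by (simp add: G_def)
    show "H \<subseteq> maps.span B"
      using HG GB by (rule subset_trans)
    show "\<forall>E\<in>B. bracket D E \<in> maps.span B"
      using GB adG[OF subsetD[OF B(2)]] by (intro ballI subsetD[OF GB])
  qed
qed

lemma weakly_locally_finite_insert_normalizing:
  assumes df: "derivation_finite scale mult"
    and S: "maps.subspace S" "S \<subseteq> Der scale mult" "weakly_locally_finite scale S"
    and D: "D \<in> LFD scale mult" and ad: "\<And>E. E \<in> S \<Longrightarrow> bracket D E \<in> S"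
  shows "weakly_locally_finite scale (insert D S)"
  unfolding weakly_locally_finite_def
proof (intro allI impI, elim conjE)
  fix F assume F: "F \<subseteq> insert D S" "finite F"
  have H: "finite (F - {D})" "F - {D} \<subseteq> S"
    using F by auto
  obtain B where B: "finite B" "B \<subseteq> S" "F - {D} \<subseteq> maps.span B"
      and adB: "\<forall>E\<in>B. bracket D E \<in> maps.span B"
    by (rule finite_ad_invariant_span[OF df S(1,2) D ad H])
  have "locally_finite scale (insert D B)"
  proof (rule locally_finite_insert_normalizing[OF _ _ _ _ bspec[OF adB]])
    show "locally_finite scale B"
      using S(3) B(1,2) by (simp add: weakly_locally_finite_def)
    show "locally_finite scale {D}" "Vector_Spaces.linear scale scale D"
      using D by (simp_all add: LFD_def linear_Der)
    show "Vector_Spaces.linear scale scale E" if "E \<in> B" for E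
      using that B(2) S(2) by (intro linear_Der) auto
  qed
  then have "locally_finite scale (maps.span (insert D B))"
    by (rule locally_finite_span)
  moreover have "f \<in> maps.span (insert D B)" if "f \<in> F" for f
  proof (cases "f = D")
    case False
    then have "f \<in> maps.span B"
      using that B(3) by auto
    then show ?thesis
      using maps.span_mono[of B "insert D B"] by auto
  qed (simp add: maps.span_base)
  then have "F \<subseteq> maps.span (insert D B)"
    by (rule subsetI)
  ultimately show "locally_finite scale F"
    by (rule locally_finite_mono)
qed

text \<open>
  Each adjunction of some \<open>D \<in> \<Delta>\<close> is followed by passing to the span, which keeps the set of maps a
  subspace. The bracket of a later element of \<open>\<Delta>\<close> with this enlarged subspace still lies in \<open>L\<close>,
  so the next adjunction is of the same kind.
\<close>

lemma weakly_locally_finite_Un: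
  assumes df: "derivation_finite scale mult"
    and L: "maps.subspace L" "L \<subseteq> Der scale mult" "weakly_locally_finite scale L"
    and \<Delta>: "\<Delta> \<subseteq> LFD scale mult"
    and ad: "\<And>D E. D \<in> \<Delta> \<Longrightarrow> E \<in> \<Delta> \<union> L \<Longrightarrow> bracket D E \<in> L"
  shows "weakly_locally_finite scale (\<Delta> \<union> L)"
proof -
  have sub_Der: "maps.span Y \<subseteq> Der scale mult" if "Y \<subseteq> Der scale mult" for Y
    using that lie_subalgebra_Der by (simp add: lie_subalgebra_iff maps.span_minimal)
  have wlf_span: "weakly_locally_finite scale (maps.span (T \<union> L))"
    if "finite T" "T \<subseteq> \<Delta>" for T
    using that
  proof (induction T rule: finite_induct)
    case empty
    then show ?case
      using L(3) by (simp add: weakly_locally_finite_span)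
  next
    case (insert D T)
    let ?S = "maps.span (T \<union> L)"
    have D: "D \<in> \<Delta>" "D \<in> LFD scale mult"
      using insert.prems \<Delta> by auto
    have "T \<union> L \<subseteq> Der scale mult"
      using insert.prems \<Delta> L(2) by (auto simp: LFD_def)
    note S_Der = sub_Der[OF this]
    have "bracket D E \<in> ?S" if E: "E \<in> ?S" for E
    proof -
      have "bracket E D \<in> L"
      proof (rule bracket_span_left[OF L(1) _ _ E])
        show "Vector_Spaces.linear scale scale D"
          using D(2) linear_Der by (simp add: LFD_def)
        show "bracket A D \<in> L" if "A \<in> T \<union> L" for A
        proof (rule bracket_commute_mem[OF L(1) ad[OF D(1)]])
          show "A \<in> \<Delta> \<union> L"
            using that insert.prems by auto
        qed
      qed
      then have "bracket D E \<in> L"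
        by (rule bracket_commute_mem[OF L(1)])
      then show ?thesis
        by (simp add: maps.span_base)
    qed
    then have "weakly_locally_finite scale (insert D ?S)"
      using insert by (intro weakly_locally_finite_insert_normalizing df S_Der D(2)) auto
    then have "weakly_locally_finite scale (maps.span (insert D ?S))"
      by (rule weakly_locally_finite_span)
    moreover have "maps.span (insert D T \<union> L) \<subseteq> maps.span (insert D ?S)"
      by (rule maps.span_mono) (auto intro: maps.span_base)
    ultimately show ?case
      by (rule weakly_locally_finite_mono)
  qed
  show ?thesis
    unfolding weakly_locally_finite_def
  proof (intro allI impI, elim conjE)
    fix F assume F: "F \<subseteq> \<Delta> \<union> L" "finite F"
    have "F \<subseteq> maps.span (F \<inter> \<Delta> \<union> L)"
      using F(1) by (auto intro: maps.span_base)
    moreover have "weakly_locally_finite scale (maps.span (F \<inter> \<Delta> \<union> L))"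
      using F(2) by (intro wlf_span) auto
    ultimately show "locally_finite scale F"
      using F(2) unfolding weakly_locally_finite_def by blast
  qed
qed

lemma bracket_span_span:
  assumes L: "maps.subspace L" and X: "X \<subseteq> Der scale mult"
    and br: "\<And>D E. D \<in> X \<Longrightarrow> E \<in> X \<Longrightarrow> bracket D E \<in> L"
    and "D \<in> maps.span X" "E \<in> maps.span X"
  shows "bracket D E \<in> L"
proof (rule bracket_span_left[OF L _ _ \<open>D \<in> maps.span X\<close>])
  have "maps.span X \<subseteq> Der scale mult"
    using X lie_subalgebra_Der by (simp add: lie_subalgebra_iff maps.span_minimal)
  then show "Vector_Spaces.linear scale scale E"
    using \<open>E \<in> maps.span X\<close> linear_Der by blast
  fix A assume "A \<in> X"
  then have "bracket E A \<in> L"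
    using X br by (intro bracket_span_left[OF L _ _ \<open>E \<in> maps.span X\<close>] linear_Der) auto
  then show "bracket A E \<in> L"
    by (rule bracket_commute_mem[OF L])
qed

text \<open>By bilinearity of the bracket, the span is itself a Lie subalgebra.\<close>

lemma lie_generated_subset_span:
  assumes "X \<subseteq> Der scale mult"
    and "\<And>D E. D \<in> X \<Longrightarrow> E \<in> X \<Longrightarrow> bracket D E \<in> maps.span X"
  shows "lie_generated scale mult X \<subseteq> maps.span X"
  unfolding lie_generated_def
proof (rule hull_minimal)
  show "X \<subseteq> maps.span X"
    by (rule maps.span_superset)
  have "maps.span X \<subseteq> Der scale mult"
    using assms(1) lie_subalgebra_Der by (simp add: lie_subalgebra_iff maps.span_minimal)
  then show "lie_subalgebra scale mult (maps.span X)"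
    using bracket_span_span[OF maps.subspace_span assms] by (simp add: lie_subalgebra_iff)
qed

end

theorem corollary3:
  fixes scale :: "'a::field \<Rightarrow> 'b::ab_group_add \<Rightarrow> 'b"
    and mult :: "'b \<Rightarrow> 'b \<Rightarrow> 'b"
    and L \<Delta> :: "('b \<Rightarrow> 'b) set"
  assumes "nonassoc_algebra scale mult"
    and "derivation_finite scale mult"
    and "lie_subalgebra scale mult L"
    and "weakly_locally_finite scale L"
    and "\<Delta> \<subseteq> LFD scale mult"
    and "bracket_set \<Delta> \<Delta> \<subseteq> L"
    and "bracket_set \<Delta> L \<subseteq> L"
  shows "weakly_locally_finite scale (lie_generated scale mult (\<Delta> \<union> L)) \<and>
    bracket_set (lie_generated scale mult (\<Delta> \<union> L)) (lie_generated scale mult (\<Delta> \<union> L)) \<subseteq> L"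
proof -
  interpret nonassoc_algebra scale mult by fact
  interpret maps: vector_space "\<lambda>c (f :: 'b \<Rightarrow> 'b) x. scale c (f x)"
    by (rule vector_space_pointwise)
  let ?M = "lie_generated scale mult (\<Delta> \<union> L)"
  have subL: "maps.subspace L" and L_Der: "L \<subseteq> Der scale mult"
    and brL: "\<And>D E. D \<in> L \<Longrightarrow> E \<in> L \<Longrightarrow> bracket D E \<in> L"
    using assms(3) by (simp_all add: lie_subalgebra_iff)
  have Der: "\<Delta> \<union> L \<subseteq> Der scale mult"
    using assms(5) L_Der by (auto simp: LFD_def)
  have ad: "bracket D E \<in> L" if "D \<in> \<Delta>" "E \<in> \<Delta> \<union> L" for D E
    using that assms(6,7) unfolding bracket_set_def by blast
  have br: "bracket D E \<in> L" if "D \<in> \<Delta> \<union> L" "E \<in> \<Delta> \<union> L" for D E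
    using that ad brL bracket_commute_mem[OF subL] by blast
  have gen: "?M \<subseteq> maps.span (\<Delta> \<union> L)"
    using br by (intro lie_generated_subset_span Der maps.span_base) auto
  have "weakly_locally_finite scale ?M"
    using weakly_locally_finite_Un[OF assms(2) subL L_Der assms(4,5) ad]
    by (intro weakly_locally_finite_mono[OF weakly_locally_finite_span gen])
  moreover have "bracket_set ?M ?M \<subseteq> L"
    using bracket_span_span[OF subL Der br] gen unfolding bracket_set_def by blast
  ultimately show ?thesis
    by blast
qed

end
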